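(* For each function $f\in C_{\phi}^{k}([0,\infty))$, $$\lim_{n\to\infty}\|V_n^{\rho}(f;\cdot)-f\|_{\phi}=0 .$$
   Context: Let $\rho:[0,\infty)\to\mathbb{R}$ be continuously differentiable on $[0,\infty)$ with $\rho(0)=0$ and $\inf_{x\in[0,\infty)}\rho'(x)\ge 1$ (so $\rho$ is a bijection of $[0,\infty)$ onto itself, with inverse $\rho^{-1}$). For $n\in\mathbb{N}$ ($n\ge 1$), $x\in[0,\infty)$ and $f:[0,\infty)\to\mathbb{R}$ for which the series converges, the generalized Baskakov operator is $$V_n^{\rho}(f;x)=\sum_{k=0}^{\infty}(f\circ\rho^{-1})\left(\frac{k}{n}\right)\binom{n+k-1}{k}\frac{(\rho(x))^k}{(1+\rho(x))^{n+k}} .$$ Put $\phi(x)=1+\rho^2(x)$, where $\rho^2(x)=(\rho(x))^2$. $B_{\phi}([0,\infty))$ is the set of all $f:[0,\infty)\to\mathbb{R}$ for which there is a constant $M_f$ (depending on $f$) with $|f(x)|\le M_f\phi(x)$ for all $x\in[0,\infty)$, normed by $\|f\|_{\phi}=\sup_{x\in[0,\infty)}\frac{|f(x)|}{\phi(x)}$. $C_{\phi}([0,\infty))$ is the set of all continuous functions in $B_{\phi}([0,\infty))$. $C_{\phi}^{k}([0,\infty))$ is the set of all $f\in C_{\phi}([0,\infty))$ for which the limit $\lim_{x\to\infty}\frac{f(x)}{\phi(x)}=k_f$ exists and is finite, with $k_f$ a constant depending on $f$ (the superscript $k$ is only notation, not a smoothness index). *)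

theory Defs
  imports "HOL-Analysis.Analysis"
begin

text \<open>
  Functions on the half-line are represented by total functions of type
  \<open>real \<Rightarrow> real\<close>; every notion below only depends on their values on \<open>{0..}\<close>.
\<close>

text \<open>
  Derivatives are taken within \<open>{0..}\<close>, hence one-sided at \<open>0\<close>. On the reals, \<open>Inf\<close>
  is meaningless for sets that are not bounded below, so boundedness is required explicitly
  (it is implied when the infimum is read in the extended reals).
\<close>

definition admissible :: "(real \<Rightarrow> real) \<Rightarrow> bool" where
  "admissible \<rho> \<longleftrightarrow>
     \<rho> 0 = 0 \<and>
     (\<exists>\<rho>'. (\<forall>x\<in>{0..}. (\<rho> has_real_derivative \<rho>' x) (at x within {0..})) \<and>
           continuous_on {0..} \<rho>' \<and>
           bdd_below (\<rho>' ` {0..}) \<and> (INF x\<in>{0..}. \<rho>' x) \<ge> 1)"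

definition weight :: "(real \<Rightarrow> real) \<Rightarrow> real \<Rightarrow> real" where
  "weight \<rho> x = 1 + (\<rho> x)\<^sup>2"

definition B_space :: "(real \<Rightarrow> real) \<Rightarrow> (real \<Rightarrow> real) set" where
  "B_space \<phi> = {f. \<exists>M. \<forall>x\<in>{0..}. \<bar>f x\<bar> \<le> M * \<phi> x}"

definition C_space :: "(real \<Rightarrow> real) \<Rightarrow> (real \<Rightarrow> real) set" where
  "C_space \<phi> = {f \<in> B_space \<phi>. continuous_on {0..} f}"

definition Ck_space :: "(real \<Rightarrow> real) \<Rightarrow> (real \<Rightarrow> real) set" where
  "Ck_space \<phi> = {f \<in> C_space \<phi>. \<exists>k. ((\<lambda>x. f x / \<phi> x) \<longlongrightarrow> k) at_top}"

text \<open>The supremum is only meaningful for elements of \<open>B_space \<phi>\<close>.\<close>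

definition weighted_norm :: "(real \<Rightarrow> real) \<Rightarrow> (real \<Rightarrow> real) \<Rightarrow> real" where
  "weighted_norm \<phi> f = (SUP x\<in>{0..}. \<bar>f x\<bar> / \<phi> x)"

definition baskakov_term ::
    "(real \<Rightarrow> real) \<Rightarrow> nat \<Rightarrow> (real \<Rightarrow> real) \<Rightarrow> real \<Rightarrow> nat \<Rightarrow> real" where
  "baskakov_term \<rho> n f x k =
     (f \<circ> inv_into {0..} \<rho>) (real k / real n) * real ((n + k - 1) choose k) *
     (\<rho> x ^ k / (1 + \<rho> x) ^ (n + k))"

text \<open>Only meaningful for \<open>n \<ge> 1\<close> and where the series converges.\<close>

definition baskakov :: "(real \<Rightarrow> real) \<Rightarrow> nat \<Rightarrow> (real \<Rightarrow> real) \<Rightarrow> real \<Rightarrow> real" where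
  "baskakov \<rho> n f x = (\<Sum>k. baskakov_term \<rho> n f x k)"

end

theory Submission
  imports Defs
begin

text \<open>
  Substituting \<open>y = \<rho> x\<close> and \<open>g = f \<circ> \<rho>\<^sup>-\<^sup>1\<close> reduces everything to the classical Baskakov operator
  on functions \<open>g\<close> with \<open>g t / (1 + t\<^sup>2)\<close> convergent at infinity. Write \<open>g t = l * (1 + t\<^sup>2) + h t\<close>,
  where \<open>l\<close> is that limit. For every \<open>e > 0\<close> there is \<open>C\<close> such that
  \<open>\<bar>h s - h t\<bar> \<le> e * (1 + s\<^sup>2) + e * (1 + t\<^sup>2) + C * (s - t)\<^sup>2\<close> for all \<open>s, t \<ge> 0\<close>.
  Averaging over the Baskakov weights, whose mean is \<open>y\<close> and whose variance is \<open>y * (1 + y) / n\<close>,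
  gives an error of at most \<open>(2 * e + C' / n) * (1 + y\<^sup>2)\<close>, uniformly in \<open>y\<close>.
\<close>

section \<open>Baskakov weights and their moments\<close>

definition baskakov_weight :: "nat \<Rightarrow> real \<Rightarrow> nat \<Rightarrow> real" where
  "baskakov_weight n y k = real ((n + k - 1) choose k) * (y ^ k / (1 + y) ^ (n + k))"

lemma baskakov_weight_nonneg: "y \<ge> 0 \<Longrightarrow> baskakov_weight n y k \<ge> 0"
  by (simp add: baskakov_weight_def)

text \<open>The weights form the negative binomial distribution with failure probability
  \<open>q = y / (1 + y)\<close>. Their total mass comes from the binomial series of
  \<open>(1 - q)\<close> to the power \<open>-n\<close>, which cancels the normalising factor
  \<open>1 / (1 + y) ^ n\<close>.\<close>

lemma baskakov_weight_sums:
  assumes "n \<ge> 1" "y \<ge> 0"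
  shows "baskakov_weight n y sums 1"
proof -
  define q where "q = y / (1 + y)"
  have q: "\<bar>- q\<bar> < 1" and q1: "1 + - q = 1 / (1 + y)"
    using assms by (auto simp: q_def field_simps)
  have "(\<lambda>k. (- real n gchoose k) * (- q) ^ k) sums (1 + - q) powr (- real n)"
    by (rule gen_binomial_real[OF q])
  also have "(1 + - q) powr (- real n) = (1 + y) ^ n"
    using assms by (simp only: q1) (simp add: powr_minus powr_realpow powr_divide divide_simps)
  finally have "(\<lambda>k. (- real n gchoose k) * (- q) ^ k * (1 / (1 + y) ^ n)) sums
      ((1 + y) ^ n * (1 / (1 + y) ^ n))"
    by (rule sums_mult2)
  moreover have "(- real n gchoose k) * (- q) ^ k * (1 / (1 + y) ^ n) = baskakov_weight n y k" for k
  proof -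
    \<comment> \<open>Since \<open>n >= 1\<close>, the truncated subtraction
      \<open>n + k - 1\<close> on \<open>nat\<close> agrees with the real one.\<close>
    have "real n + real k - 1 = real (n + k - 1)"
      using assms by (simp add: of_nat_diff)
    then have "(- real n gchoose k) = (- 1) ^ k * real ((n + k - 1) choose k)"
      by (simp only: gbinomial_minus binomial_gbinomial)
    then have "(- real n gchoose k) * (- q) ^ k * (1 / (1 + y) ^ n)
        = ((- 1) ^ k * (- 1) ^ k) * (real ((n + k - 1) choose k) * (q ^ k * (1 / (1 + y) ^ n)))"
      by (simp only: power_minus[of q] mult_ac)
    also have "(- 1) ^ k * (- 1) ^ k = (1 :: real)"
      by (simp flip: power_mult_distrib)
    finally show ?thesis
      by (simp add: baskakov_weight_def q_def power_add power_divide)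
  qed
  ultimately show ?thesis
    using assms by simp
qed

text \<open>Absorption of the binomial coefficient. A factor \<open>k\<close> in a moment is traded
  for a shift from \<open>n\<close> to \<open>n + 1\<close>, so each moment reduces to lower moments
  of the shifted weights.\<close>

lemma baskakov_weight_Suc:
  assumes "n \<ge> 1"
  shows "real (Suc k) * baskakov_weight n y (Suc k) = real n * y * baskakov_weight (Suc n) y k"
proof -
  obtain m where m: "n = Suc m"
    using assms by (cases n) auto
  have "Suc k * (Suc (m + k) choose Suc k) = Suc m * (Suc (m + k) choose k)"
    using Suc_times_binomial_eq[of "m + k" k] binomial_absorb_comp[of "Suc (m + k)" k]
    by (simp add: Suc_diff_le mult.commute del: binomial_Suc_Suc mult_Suc mult_Suc_right)
  then have "real (Suc k) * real (Suc (m + k) choose Suc k)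
      = real (Suc m) * real (Suc (m + k) choose k)"
    by (metis of_nat_mult)
  then show ?thesis
    by (simp add: baskakov_weight_def m del: of_nat_Suc binomial_Suc_Suc)
qed

lemma baskakov_weight_moment1:
  assumes "n \<ge> 1" "y \<ge> 0"
  shows "(\<lambda>k. real k * baskakov_weight n y k) sums (real n * y)"
proof -
  have "(\<lambda>k. real n * y * baskakov_weight (Suc n) y k) sums (real n * y * 1)"
    using assms by (intro sums_mult baskakov_weight_sums) auto
  then show ?thesis
    \<comment> \<open>The term at \<open>k = 0\<close> vanishes, so dropping it in the index shift
      leaves the sum unchanged.\<close>
    using assms sums_Suc_iff[of "\<lambda>k. real k * baskakov_weight n y k" "real n * y"]
    by (simp only: baskakov_weight_Suc) simp
qed

lemma baskakov_weight_moment2: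
  assumes "n \<ge> 1" "y \<ge> 0"
  shows "(\<lambda>k. (real k)\<^sup>2 * baskakov_weight n y k) sums (real n * y * (1 + real (Suc n) * y))"
proof -
  \<comment> \<open>One factor \<open>k + 1\<close> of the square is absorbed; the other splits into
    \<open>1 + k\<close> and is summed by the moments of order 0 and 1 at \<open>n + 1\<close>.
    Hence the \<open>Suc n\<close> in the result.\<close>
  have "(\<lambda>k. real n * y * (baskakov_weight (Suc n) y k + real k * baskakov_weight (Suc n) y k)) sums
      (real n * y * (1 + real (Suc n) * y))"
    using assms by (intro sums_mult sums_add baskakov_weight_sums baskakov_weight_moment1) auto
  moreover have "real n * y * (baskakov_weight (Suc n) y k + real k * baskakov_weight (Suc n) y k)
      = (real (Suc k))\<^sup>2 * baskakov_weight n y (Suc k)" for k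
  proof -
    have "(real (Suc k))\<^sup>2 * baskakov_weight n y (Suc k)
        = real (Suc k) * (real (Suc k) * baskakov_weight n y (Suc k))"
      by (simp only: power2_eq_square mult.assoc)
    also have "\<dots> = real (Suc k) * (real n * y * baskakov_weight (Suc n) y k)"
      by (simp only: baskakov_weight_Suc[OF assms(1)])
    finally show ?thesis
      by (simp add: algebra_simps)
  qed
  ultimately show ?thesis
    using sums_Suc_iff[of "\<lambda>k. (real k)\<^sup>2 * baskakov_weight n y k"] by simp
qed

lemma baskakov_weight_square:
  assumes "n \<ge> 1" "y \<ge> 0"
  shows "(\<lambda>k. (real k / real n)\<^sup>2 * baskakov_weight n y k) sums (y\<^sup>2 + y * (1 + y) / real n)"
proof -
  have "(\<lambda>k. 1 / (real n)\<^sup>2 * ((real k)\<^sup>2 * baskakov_weight n y k)) sums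
      (1 / (real n)\<^sup>2 * (real n * y * (1 + real (Suc n) * y)))"
    by (intro sums_mult baskakov_weight_moment2 assms)
  moreover have "1 / (real n)\<^sup>2 * (real n * y * (1 + real (Suc n) * y)) = y\<^sup>2 + y * (1 + y) / real n"
    using assms by (simp add: field_simps power2_eq_square)
  ultimately show ?thesis
    by (simp add: power_divide)
qed

lemma baskakov_weight_variance:
  assumes "n \<ge> 1" "y \<ge> 0"
  shows "(\<lambda>k. (real k / real n - y)\<^sup>2 * baskakov_weight n y k) sums (y * (1 + y) / real n)"
proof -
  have "(\<lambda>k. (real k / real n)\<^sup>2 * baskakov_weight n y k
        - 2 * y / real n * (real k * baskakov_weight n y k) + y\<^sup>2 * baskakov_weight n y k) sums
      (y\<^sup>2 + y * (1 + y) / real n - 2 * y / real n * (real n * y) + y\<^sup>2 * 1)"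
    by (intro sums_add sums_diff sums_mult baskakov_weight_square baskakov_weight_moment1
        baskakov_weight_sums assms)
  moreover have "y\<^sup>2 + y * (1 + y) / real n - 2 * y / real n * (real n * y) + y\<^sup>2 * 1
      = y * (1 + y) / real n"
    using assms by (simp add: power2_eq_square)
  ultimately show ?thesis
    by (simp add: power2_diff algebra_simps)
qed

section \<open>Quadratic increment bound and the uniform error estimate\<close>

lemma increment_bound_of_tendsto_zero:
  fixes h :: "real \<Rightarrow> real"
  assumes cont: "continuous_on {0..} h"
    and lim: "((\<lambda>t. h t / (1 + t\<^sup>2)) \<longlongrightarrow> 0) at_top"
    and "e > 0"
  obtains C where "C \<ge> 0" "\<And>s t. s \<ge> 0 \<Longrightarrow> t \<ge> 0 \<Longrightarrow>
      \<bar>h s - h t\<bar> \<le> e * (1 + s\<^sup>2) + e * (1 + t\<^sup>2) + C * (s - t)\<^sup>2"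
proof -
  have w: "1 + t\<^sup>2 > 0" for t :: real
    by (simp add: add_pos_nonneg)
  obtain T0 where T0: "\<And>t. t \<ge> T0 \<Longrightarrow> \<bar>h t / (1 + t\<^sup>2)\<bar> < e"
    using tendstoD[OF lim \<open>e > 0\<close>] by (auto simp: eventually_at_top_linorder)
  define T where "T = max T0 0"
  have T: "\<bar>h t\<bar> \<le> e * (1 + t\<^sup>2)" if "t \<ge> T" for t
    using T0[of t] that w[of t] by (simp add: T_def abs_divide divide_simps split: if_splits)
  have cI: "continuous_on {0..T + 1} h"
    using cont by (rule continuous_on_subset) auto
  have "bounded (h ` {0..T + 1})"
    by (intro compact_imp_bounded compact_continuous_image cI) simp
  then obtain M where M: "M > 0" "\<And>t. t \<in> {0..T + 1} \<Longrightarrow> \<bar>h t\<bar> \<le> M"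
    by (auto simp: bounded_pos)
  have "uniformly_continuous_on {0..T + 1} h"
    by (intro compact_uniformly_continuous cI) simp
  then obtain d where d: "d > 0" "\<And>s t. s \<in> {0..T + 1} \<Longrightarrow> t \<in> {0..T + 1} \<Longrightarrow>
      \<bar>s - t\<bar> < d \<Longrightarrow> \<bar>h s - h t\<bar> < e"
    using \<open>e > 0\<close> unfolding uniformly_continuous_on_def dist_real_def by metis
  \<comment> \<open>The first summand serves pairs in \<open>{0..T + 1}\<close> at distance at least
    \<open>d\<close>, where \<open>(s - t)^2 / d^2 >= 1\<close>. The second serves pairs lying on
    opposite sides of the gap between \<open>T\<close> and \<open>T + 1\<close>, where
    \<open>(s - t)^2 >= 1\<close>.\<close>
  define C where "C = 2 * M / d\<^sup>2 + M"
  have C0: "C \<ge> 0"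
    using M(1) by (simp add: C_def)
  have bound: "\<bar>h s - h t\<bar> \<le> e * (1 + s\<^sup>2) + e * (1 + t\<^sup>2) + C * (s - t)\<^sup>2"
    if st: "s \<ge> 0" "t \<ge> 0" "s \<le> t" for s t
  proof -
    \<comment> \<open>For \<open>s <= t\<close>, both points lie in the tail, or both lie in the
      compact interval, or they are more than 1 apart. Extending the interval to
      \<open>T + 1\<close> is what forces this separation in the last case.\<close>
    consider "s \<ge> T" | "t \<le> T + 1" | "s < T" "t > T + 1"
      by linarith
    then show ?thesis
    proof cases
      case 1
      have "C * (s - t)\<^sup>2 \<ge> 0"
        using C0 by simp
      then show ?thesis
        using T[of s] T[of t] 1 st by linarith
    next
      case 2
      show ?thesis
      proof (cases "\<bar>s - t\<bar> < d")
        case True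
        have "\<bar>h s - h t\<bar> < e"
          using d(2)[of s t] True 2 st by auto
        moreover have "e \<le> e * (1 + s\<^sup>2)" "e * (1 + t\<^sup>2) \<ge> 0" "C * (s - t)\<^sup>2 \<ge> 0"
          using C0 \<open>e > 0\<close> by (auto simp: algebra_simps)
        ultimately show ?thesis
          by linarith
      next
        case False
        then have "\<bar>d\<bar> \<le> \<bar>s - t\<bar>"
          using d(1) by simp
        then have "d\<^sup>2 \<le> (s - t)\<^sup>2"
          by (simp only: abs_le_square_iff)
        then have "2 * M \<le> 2 * M / d\<^sup>2 * (s - t)\<^sup>2"
          using M(1) d(1) by (simp add: field_simps)
        moreover have "2 * M / d\<^sup>2 * (s - t)\<^sup>2 \<le> C * (s - t)\<^sup>2"
          using M(1) by (intro mult_right_mono) (auto simp: C_def)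
        moreover have "\<bar>h s - h t\<bar> \<le> 2 * M"
          using M(2)[of s] M(2)[of t] 2 st by auto
        moreover have "e * (1 + s\<^sup>2) \<ge> 0" "e * (1 + t\<^sup>2) \<ge> 0"
          using \<open>e > 0\<close> by auto
        ultimately show ?thesis
          by linarith
      qed
    next
      case 3
      then have "(s - t)\<^sup>2 \<ge> 1"
        using one_le_power[of "t - s" 2] by (simp add: power2_commute)
      then have "M * 1 \<le> C * (s - t)\<^sup>2"
        using M(1) C0 by (intro mult_mono) (auto simp: C_def)
      moreover have "\<bar>h s\<bar> \<le> M" "\<bar>h t\<bar> \<le> e * (1 + t\<^sup>2)" "e * (1 + s\<^sup>2) \<ge> 0"
        using M(2)[of s] T[of t] 3 st \<open>e > 0\<close> by auto
      ultimately show ?thesis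
        by linarith
    qed
  qed
  show ?thesis
  proof (rule that[OF C0])
    fix s t :: real
    assume "s \<ge> 0" "t \<ge> 0"
    then show "\<bar>h s - h t\<bar> \<le> e * (1 + s\<^sup>2) + e * (1 + t\<^sup>2) + C * (s - t)\<^sup>2"
      using bound[of s t] bound[of t s]
      by (cases "s \<le> t") (auto simp: power2_commute[of t s] abs_minus_commute)
  qed
qed

lemma baskakov_weight_summable:
  assumes g: "\<And>t. t \<ge> 0 \<Longrightarrow> \<bar>g t\<bar> \<le> M * (1 + t\<^sup>2)" and "n \<ge> 1" "y \<ge> 0"
  shows "summable (\<lambda>k. g (real k / real n) * baskakov_weight n y k)"
proof (rule summable_comparison_test')
  show "summable (\<lambda>k. M * (baskakov_weight n y k
      + (real k / real n)\<^sup>2 * baskakov_weight n y k))"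
    by (intro summable_mult summable_add sums_summable[OF baskakov_weight_sums]
        sums_summable[OF baskakov_weight_square] assms)
next
  fix k
  have "\<bar>g (real k / real n)\<bar> * baskakov_weight n y k
      \<le> M * (1 + (real k / real n)\<^sup>2) * baskakov_weight n y k"
    using baskakov_weight_nonneg[OF \<open>y \<ge> 0\<close>] by (intro mult_right_mono g) auto
  then show "norm (g (real k / real n) * baskakov_weight n y k)
      \<le> M * (baskakov_weight n y k + (real k / real n)\<^sup>2 * baskakov_weight n y k)"
    using baskakov_weight_nonneg[OF \<open>y \<ge> 0\<close>, of n k] by (simp add: abs_mult algebra_simps)
qed

text \<open>The constant is fixed before \<open>n\<close> and \<open>y\<close>. This uniformity is
  what lets the estimate pass to the weighted supremum.\<close>

lemma baskakov_weight_error: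
  fixes g :: "real \<Rightarrow> real"
  assumes cont: "continuous_on {0..} g"
    and g: "\<And>t. t \<ge> 0 \<Longrightarrow> \<bar>g t\<bar> \<le> M * (1 + t\<^sup>2)"
    and lim: "((\<lambda>t. g t / (1 + t\<^sup>2)) \<longlongrightarrow> l) at_top"
    and "e > 0"
  obtains C where "C \<ge> 0" "\<And>n y. n \<ge> 1 \<Longrightarrow> y \<ge> 0 \<Longrightarrow>
      \<bar>(\<Sum>k. g (real k / real n) * baskakov_weight n y k) - g y\<bar> \<le> (e + C / real n) * (1 + y\<^sup>2)"
proof -
  define h where "h t = g t - l * (1 + t\<^sup>2)" for t
  have "((\<lambda>t. g t / (1 + t\<^sup>2) - l) \<longlongrightarrow> l - l) at_top"
    by (intro tendsto_diff lim tendsto_const)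
  moreover have "g t / (1 + t\<^sup>2) - l = h t / (1 + t\<^sup>2)" for t
    using add_pos_nonneg[of 1 "t\<^sup>2"] by (simp add: h_def field_simps)
  ultimately have h_lim: "((\<lambda>t. h t / (1 + t\<^sup>2)) \<longlongrightarrow> 0) at_top"
    by simp
  have h_cont: "continuous_on {0..} h"
    unfolding h_def by (intro continuous_intros cont)
  have e4: "e / 4 > 0"
    using \<open>e > 0\<close> by simp
  obtain C where C: "C \<ge> 0" "\<And>s t. s \<ge> 0 \<Longrightarrow> t \<ge> 0 \<Longrightarrow>
      \<bar>h s - h t\<bar> \<le> e / 4 * (1 + s\<^sup>2) + e / 4 * (1 + t\<^sup>2) + C * (s - t)\<^sup>2"
    using increment_bound_of_tendsto_zero[OF h_cont h_lim e4] by metis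
  \<comment> \<open>Three terms are multiples of the variance \<open>v\<close>: the quadratic part
    costs \<open>|l| * v\<close>, averaging \<open>e / 4 * (1 + s^2)\<close> adds
    \<open>e / 4 * v\<close>, and the squared increment costs \<open>C * v\<close>. The factor 2
    comes from \<open>y * (1 + y) <= 2 * (1 + y^2)\<close>.\<close>
  define D where "D = 2 * (\<bar>l\<bar> + e / 4 + C)"
  have "D \<ge> 0"
    using C(1) \<open>e > 0\<close> by (simp add: D_def)
  moreover have "\<bar>(\<Sum>k. g (real k / real n) * baskakov_weight n y k) - g y\<bar>
      \<le> (e + D / real n) * (1 + y\<^sup>2)" if "n \<ge> 1" "y \<ge> 0" for n y
  proof -
    define b where "b = baskakov_weight n y"
    define t where "t k = real k / real n" for k
    define v where "v = y * (1 + y) / real n"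
    have b_nonneg: "b k \<ge> 0" for k
      unfolding b_def using that by (intro baskakov_weight_nonneg)
    have t_nonneg: "t k \<ge> 0" for k
      by (simp add: t_def)
    have s0: "b sums 1"
      and s2: "(\<lambda>k. (t k)\<^sup>2 * b k) sums (y\<^sup>2 + v)"
      and sv: "(\<lambda>k. (t k - y)\<^sup>2 * b k) sums v"
      unfolding b_def t_def v_def
      using baskakov_weight_sums baskakov_weight_square baskakov_weight_variance that by blast+
    have v: "0 \<le> v" "v \<le> 2 * (1 + y\<^sup>2) / real n"
    proof -
      have "y * (1 + y) \<le> 2 * (1 + y\<^sup>2)"
        using sum_squares_bound[of y 1] \<open>y \<ge> 0\<close> by (simp add: power2_eq_square algebra_simps)
      then show "v \<le> 2 * (1 + y\<^sup>2) / real n"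
        unfolding v_def by (intro divide_right_mono) auto
    qed (use that in \<open>simp add: v_def\<close>)
    have sg: "(\<lambda>k. g (t k) * b k) sums (\<Sum>k. g (t k) * b k)"
      unfolding t_def b_def using that by (intro summable_sums baskakov_weight_summable[of g M] g)
    \<comment> \<open>Averaging preserves constants and sends the square function to
      \<open>y^2 + v\<close>. The part \<open>l * (1 + t^2)\<close> of \<open>g\<close> therefore
      contributes exactly \<open>l * v\<close> to the error.\<close>
    have "(\<lambda>k. g (t k) * b k - g y * b k - l * ((t k)\<^sup>2 * b k - y\<^sup>2 * b k)) sums
        ((\<Sum>k. g (t k) * b k) - g y * 1 - l * (y\<^sup>2 + v - y\<^sup>2 * 1))"
      by (intro sums_diff sums_mult sg s0 s2)
    moreover have "g (t k) * b k - g y * b k - l * ((t k)\<^sup>2 * b k - y\<^sup>2 * b k)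
        = (h (t k) - h y) * b k" for k
      by (simp add: h_def algebra_simps)
    ultimately have sh: "(\<lambda>k. (h (t k) - h y) * b k) sums ((\<Sum>k. g (t k) * b k) - g y - l * v)"
      by simp
    have "(\<lambda>k. e / 4 * (b k + (t k)\<^sup>2 * b k) + e / 4 * (1 + y\<^sup>2) * b k
          + C * ((t k - y)\<^sup>2 * b k)) sums
        (e / 4 * (1 + (y\<^sup>2 + v)) + e / 4 * (1 + y\<^sup>2) * 1 + C * v)"
      by (intro sums_add sums_mult s0 s2 sv)
    moreover have "e / 4 * (b k + (t k)\<^sup>2 * b k) + e / 4 * (1 + y\<^sup>2) * b k
          + C * ((t k - y)\<^sup>2 * b k)
        = (e / 4 * (1 + (t k)\<^sup>2) + e / 4 * (1 + y\<^sup>2) + C * (t k - y)\<^sup>2) * b k" for k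
      by (simp add: algebra_simps)
    ultimately have sB: "(\<lambda>k. (e / 4 * (1 + (t k)\<^sup>2) + e / 4 * (1 + y\<^sup>2)
          + C * (t k - y)\<^sup>2) * b k) sums
        (e / 4 * (1 + (y\<^sup>2 + v)) + e / 4 * (1 + y\<^sup>2) + C * v)"
      by simp
    have "norm (\<Sum>k. (h (t k) - h y) * b k) \<le>
        (\<Sum>k. (e / 4 * (1 + (t k)\<^sup>2) + e / 4 * (1 + y\<^sup>2) + C * (t k - y)\<^sup>2) * b k)"
    proof (rule norm_suminf_le)
      fix k
      show "norm ((h (t k) - h y) * b k)
          \<le> (e / 4 * (1 + (t k)\<^sup>2) + e / 4 * (1 + y\<^sup>2) + C * (t k - y)\<^sup>2) * b k"
        using C(2)[OF t_nonneg \<open>y \<ge> 0\<close>, of k] b_nonneg[of k]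
        by (auto simp: abs_mult intro!: mult_right_mono)
    qed (use sB in \<open>simp add: sums_iff\<close>)
    then have "\<bar>(\<Sum>k. g (t k) * b k) - g y - l * v\<bar>
        \<le> e / 4 * (1 + (y\<^sup>2 + v)) + e / 4 * (1 + y\<^sup>2) + C * v"
      using sB sh by (simp add: sums_iff)
    then have "\<bar>(\<Sum>k. g (t k) * b k) - g y\<bar>
        \<le> \<bar>l * v\<bar> + (e / 4 * (1 + (y\<^sup>2 + v)) + e / 4 * (1 + y\<^sup>2) + C * v)"
      by linarith
    also have "\<dots> = e / 2 * (1 + y\<^sup>2) + (\<bar>l\<bar> + e / 4 + C) * v"
      using v(1) by (simp add: abs_mult algebra_simps)
    also have "\<dots> \<le> e * (1 + y\<^sup>2) + (\<bar>l\<bar> + e / 4 + C) * (2 * (1 + y\<^sup>2) / real n)"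
      using v C(1) \<open>e > 0\<close> by (intro add_mono mult_left_mono mult_right_mono) auto
    also have "\<dots> = (e + D / real n) * (1 + y\<^sup>2)"
      by (simp add: D_def algebra_simps add_divide_distrib)
    finally show ?thesis
      by (simp add: t_def b_def)
  qed
  ultimately show ?thesis
    by (rule that)
qed

section \<open>Admissible functions and their inverses\<close>

lemma admissible_continuous:
  assumes "admissible \<rho>"
  shows "continuous_on {0..} \<rho>"
proof -
  obtain \<rho>' where "\<And>z. z \<in> {0..} \<Longrightarrow> (\<rho> has_real_derivative \<rho>' z) (at z within {0..})"
    using assms unfolding admissible_def by blast
  then show ?thesis
    by (rule DERIV_continuous_on)
qed

text \<open>The function \<open>\<rho> z - z\<close> is nondecreasing, its derivative being at least
  \<open>1 - 1 = 0\<close>. Injectivity, growth and the regularity of the inverse all follow from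
  this expansion property.\<close>

lemma admissible_expanding:
  assumes "admissible \<rho>" "0 \<le> x" "x \<le> y"
  shows "y - x \<le> \<rho> y - \<rho> x"
proof -
  obtain \<rho>' where d: "\<And>z. z \<in> {0..} \<Longrightarrow> (\<rho> has_real_derivative \<rho>' z) (at z within {0..})"
    and bdd: "bdd_below (\<rho>' ` {0..})" and inf: "(INF z\<in>{0..}. \<rho>' z) \<ge> 1"
    using assms(1) unfolding admissible_def by blast
  have ge1: "\<rho>' z \<ge> 1" if "z \<ge> 0" for z
    using cINF_lower[OF bdd, of z] inf that by auto
  have "\<rho> x - x \<le> \<rho> y - y"
  proof (rule DERIV_nonneg_imp_increasing_open[OF \<open>x \<le> y\<close>])
    fix z
    assume "x < z" "z < y"
    then have z: "z > 0"
      using assms(2) by simp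
    \<comment> \<open>A point \<open>z > 0\<close> is interior to the half-line, so the derivative
      within \<open>{0..}\<close> is two-sided there. The endpoint 0 is covered by continuity
      alone.\<close>
    then have "(\<rho> has_real_derivative \<rho>' z) (at z)"
      using d[of z] at_within_interior[of z "{0..}"] by simp
    then have "((\<lambda>z. \<rho> z - z) has_real_derivative \<rho>' z - 1) (at z)"
      by (auto intro!: derivative_eq_intros)
    then show "\<exists>D. ((\<lambda>z. \<rho> z - z) has_real_derivative D) (at z) \<and> 0 \<le> D"
      using ge1[of z] z by (intro exI[of _ "\<rho>' z - 1"]) simp
  next
    show "continuous_on {x..y} (\<lambda>z. \<rho> z - z)"
      using assms(2)
      by (intro continuous_intros continuous_on_subset[OF admissible_continuous[OF assms(1)]]) auto
  qed
  then show ?thesis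
    by simp
qed

lemma admissible_ge:
  assumes "admissible \<rho>" "x \<ge> 0"
  shows "x \<le> \<rho> x"
  using admissible_expanding[of \<rho> 0 x] assms by (simp add: admissible_def)

lemma admissible_inj_on:
  assumes "admissible \<rho>"
  shows "inj_on \<rho> {0..}"
proof (rule linorder_inj_onI)
  fix x y :: real
  assume "x < y" "x \<in> {0..}"
  then show "\<rho> x \<noteq> \<rho> y"
    using admissible_expanding[OF assms, of x y] by auto
qed auto

text \<open>Surjectivity is the intermediate value theorem on \<open>{0..y}\<close>, whose endpoint
  values enclose \<open>y\<close> because \<open>y <= \<rho> y\<close>.\<close>

lemma admissible_image:
  assumes "admissible \<rho>"
  shows "\<rho> ` {0..} = {0..}"
proof
  show "\<rho> ` {0..} \<subseteq> {0..}"
    using admissible_ge[OF assms] by force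
  show "{0..} \<subseteq> \<rho> ` {0..}"
  proof
    fix y :: real
    assume y: "y \<in> {0..}"
    have "continuous_on {0..y} \<rho>"
      using admissible_continuous[OF assms] by (rule continuous_on_subset) auto
    moreover have "\<rho> 0 \<le> y" "y \<le> \<rho> y"
      using y admissible_ge[OF assms] assms by (auto simp: admissible_def)
    ultimately obtain x where "0 \<le> x" "\<rho> x = y"
      using IVT'[of \<rho> 0 y y] y by auto
    then show "y \<in> \<rho> ` {0..}"
      by auto
  qed
qed

lemma admissible_inv_into:
  assumes "admissible \<rho>" "t \<ge> 0"
  shows "inv_into {0..} \<rho> t \<ge> 0" "\<rho> (inv_into {0..} \<rho> t) = t"
  using inv_into_into[of t \<rho> "{0..}"] f_inv_into_f[of t \<rho> "{0..}"] admissible_image[OF assms(1)]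
    assms(2) by auto

text \<open>The inverse of an expanding map is 1-Lipschitz.\<close>

lemma admissible_inv_into_continuous:
  assumes "admissible \<rho>"
  shows "continuous_on {0..} (inv_into {0..} \<rho>)"
proof -
  have le: "\<bar>inv_into {0..} \<rho> s - inv_into {0..} \<rho> t\<bar> \<le> \<bar>s - t\<bar>" if "s \<ge> 0" "t \<ge> 0" for s t
    using admissible_expanding[OF assms, of "inv_into {0..} \<rho> s" "inv_into {0..} \<rho> t"]
      admissible_expanding[OF assms, of "inv_into {0..} \<rho> t" "inv_into {0..} \<rho> s"]
      admissible_inv_into[OF assms, of s] admissible_inv_into[OF assms, of t] that
    by linarith
  show ?thesis
    unfolding continuous_on_iff dist_real_def
    using le by (meson atLeast_iff le_less_trans)
qed

text \<open>This permits the substitution of the inverse into the limit at infinity that defines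
  \<open>Ck_space\<close>.\<close>

lemma admissible_inv_into_at_top:
  assumes "admissible \<rho>"
  shows "filterlim (inv_into {0..} \<rho>) at_top at_top"
proof (rule filterlim_at_top_ge[THEN iffD2, of 0], intro allI impI)
  fix Z :: real
  assume Z: "Z \<ge> 0"
  have "Z \<le> inv_into {0..} \<rho> t" if "t \<ge> \<rho> Z" for t
  proof (rule ccontr)
    assume "\<not> Z \<le> inv_into {0..} \<rho> t"
    moreover have "t \<ge> 0"
      using that admissible_ge[OF assms Z] Z by simp
    ultimately show False
      using admissible_expanding[OF assms, of "inv_into {0..} \<rho> t" Z]
        admissible_inv_into[OF assms, of t] that by simp
  qed
  then show "\<forall>\<^sub>F t in at_top. Z \<le> inv_into {0..} \<rho> t"
    by (auto simp: eventually_at_top_linorder)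
qed

section \<open>Transfer to the generalized operator\<close>

theorem theorem2:
  fixes \<rho> f :: "real \<Rightarrow> real"
  assumes "admissible \<rho>"
    and "f \<in> Ck_space (weight \<rho>)"
  shows "(\<forall>n\<ge>1. \<forall>x\<in>{0..}. summable (baskakov_term \<rho> n f x)) \<and>
    (\<forall>n\<ge>1. (\<lambda>x. baskakov \<rho> n f x - f x) \<in> B_space (weight \<rho>)) \<and>
    (\<lambda>n. weighted_norm (weight \<rho>) (\<lambda>x. baskakov \<rho> n f x - f x)) \<longlonglongrightarrow> 0"
proof -
  note inv = admissible_inv_into[OF assms(1)]
  define g where "g = f \<circ> inv_into {0..} \<rho>"
  obtain M l where M: "\<And>x. x \<ge> 0 \<Longrightarrow> \<bar>f x\<bar> \<le> M * weight \<rho> x"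
    and cont: "continuous_on {0..} f" and lim: "((\<lambda>x. f x / weight \<rho> x) \<longlongrightarrow> l) at_top"
    using assms(2) unfolding Ck_space_def C_space_def B_space_def by auto
  have g: "\<bar>g t\<bar> \<le> M * (1 + t\<^sup>2)" if "t \<ge> 0" for t
    using M[OF inv(1)[OF that]] inv(2)[OF that] by (simp add: g_def weight_def)
  have g_cont: "continuous_on {0..} g"
    unfolding g_def
    by (intro continuous_on_compose admissible_inv_into_continuous assms(1)
        continuous_on_subset[OF cont]) (auto intro: inv(1))
  have "((\<lambda>t. f (inv_into {0..} \<rho> t) / weight \<rho> (inv_into {0..} \<rho> t)) \<longlongrightarrow> l) at_top"
    by (rule filterlim_compose[OF lim admissible_inv_into_at_top[OF assms(1)]])
  \<comment> \<open>The identity is claimed only eventually: for negative \<open>t\<close>, outside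
    the image of \<open>{0..}\<close>, the value of \<open>inv_into\<close> is arbitrary.\<close>
  moreover have "\<forall>\<^sub>F t in at_top.
      f (inv_into {0..} \<rho> t) / weight \<rho> (inv_into {0..} \<rho> t) = g t / (1 + t\<^sup>2)"
    using eventually_ge_at_top[of 0] by eventually_elim (simp add: g_def weight_def inv(2))
  ultimately have g_lim: "((\<lambda>t. g t / (1 + t\<^sup>2)) \<longlongrightarrow> l) at_top"
    by (rule Lim_transform_eventually)
  have term_eq: "baskakov_term \<rho> n f x = (\<lambda>k. g (real k / real n) * baskakov_weight n (\<rho> x) k)"
    for n x
    by (simp add: fun_eq_iff baskakov_term_def g_def baskakov_weight_def mult.assoc)
  have \<rho>_nonneg: "\<rho> x \<ge> 0" if "x \<ge> 0" for x
    using admissible_ge[OF assms(1) that] that by simp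
  have g_\<rho>: "g (\<rho> x) = f x" if "x \<ge> 0" for x
    using inv_into_f_f[OF admissible_inj_on[OF assms(1)], of x] that by (simp add: g_def)
  \<comment> \<open>Used twice: with \<open>e = 1\<close> for membership in \<open>B_space\<close>,
    and with \<open>e = r / 2\<close> for the limit.\<close>
  have error: "\<exists>C\<ge>0. \<forall>n\<ge>1. \<forall>x\<ge>0.
      \<bar>baskakov \<rho> n f x - f x\<bar> \<le> (e + C / real n) * weight \<rho> x" if e: "e > 0" for e
  proof -
    obtain C where C: "C \<ge> 0" "\<And>n y. n \<ge> 1 \<Longrightarrow> y \<ge> 0 \<Longrightarrow>
        \<bar>(\<Sum>k. g (real k / real n) * baskakov_weight n y k) - g y\<bar> \<le> (e + C / real n) * (1 + y\<^sup>2)"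
      using baskakov_weight_error[OF g_cont g g_lim e] by blast
    have "\<bar>baskakov \<rho> n f x - f x\<bar> \<le> (e + C / real n) * weight \<rho> x" if "n \<ge> 1" "x \<ge> 0" for n x
      using C(2)[OF that(1) \<rho>_nonneg[OF that(2)]] g_\<rho>[OF that(2)]
      by (simp add: baskakov_def term_eq weight_def)
    then show ?thesis
      using C(1) by blast
  qed
  \<comment> \<open>Together with \<open>B_space\<close> below, this ensures that for
    \<open>n >= 1\<close> the infinite sum and the supremum in the limit are genuine and not default
    values.\<close>
  have summable: "summable (baskakov_term \<rho> n f x)" if "n \<ge> 1" "x \<ge> 0" for n x
    unfolding term_eq using that by (intro baskakov_weight_summable[of g M] g \<rho>_nonneg)
  have B_space: "(\<lambda>x. baskakov \<rho> n f x - f x) \<in> B_space (weight \<rho>)" if "n \<ge> 1" for n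
  proof -
    obtain C where "\<forall>n\<ge>1. \<forall>x\<ge>0.
        \<bar>baskakov \<rho> n f x - f x\<bar> \<le> (1 + C / real n) * weight \<rho> x"
      using error[OF zero_less_one] by (elim exE conjE)
    with that have "\<forall>x\<in>{0..}. \<bar>baskakov \<rho> n f x - f x\<bar> \<le> (1 + C / real n) * weight \<rho> x"
      by simp
    then show ?thesis
      unfolding B_space_def by (intro CollectI exI)
  qed
  have limit: "(\<lambda>n. weighted_norm (weight \<rho>) (\<lambda>x. baskakov \<rho> n f x - f x)) \<longlonglongrightarrow> 0"
  proof (rule LIMSEQ_I)
    fix r :: real
    assume r: "r > 0"
    then obtain C where C: "C \<ge> 0" "\<And>n x. n \<ge> 1 \<Longrightarrow> x \<ge> 0 \<Longrightarrow>
        \<bar>baskakov \<rho> n f x - f x\<bar> \<le> (r / 2 + C / real n) * weight \<rho> x"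
      using error[of "r / 2"] by auto
    \<comment> \<open>Beyond \<open>N\<close> the term \<open>C / n\<close> drops below
      \<open>r / 2\<close>; the maximum with 1 taken next excludes the degenerate index
      \<open>n = 0\<close>.\<close>
    obtain N where N: "real N > 2 * C / r"
      using reals_Archimedean2 by blast
    have "\<bar>weighted_norm (weight \<rho>) (\<lambda>x. baskakov \<rho> n f x - f x)\<bar> < r" if n: "n \<ge> max 1 N" for n
    proof -
      define q where "q x = \<bar>baskakov \<rho> n f x - f x\<bar> / weight \<rho> x" for x
      have w: "weight \<rho> x > 0" for x
        by (simp add: weight_def add_pos_nonneg)
      have q: "0 \<le> q x" "q x \<le> r / 2 + C / real n" if "x \<ge> 0" for x
        using C(2)[of n x] w[of x] n that by (auto simp: q_def pos_divide_le_eq)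
      have "(SUP x\<in>{0..}. q x) \<le> r / 2 + C / real n"
        using q(2) by (intro cSUP_least) auto
      \<comment> \<open>The absolute value of the supremum also needs a lower bound: it is at least
        \<open>q 0\<close>, hence nonnegative.\<close>
      moreover have "q 0 \<le> (SUP x\<in>{0..}. q x)"
        using q(2) by (intro cSUP_upper) (auto intro!: bdd_aboveI2)
      moreover have "C / real n < r / 2"
      proof -
        have "2 * C / r < real n"
          using N n by simp
        then show ?thesis
          using r n by (simp add: field_simps)
      qed
      ultimately have "\<bar>SUP x\<in>{0..}. q x\<bar> < r"
        using q(1)[of 0] by linarith
      then show ?thesis
        by (simp add: weighted_norm_def q_def)
    qed
    then show "\<exists>no. \<forall>n\<ge>no. norm (weighted_norm (weight \<rho>) (\<lambda>x. baskakov \<rho> n f x - f x) - 0) < r"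
      unfolding diff_0_right real_norm_def by (intro exI[of _ "max 1 N"] allI impI)
  qed
  show ?thesis
    by (intro conjI allI impI ballI summable B_space limit) auto
qed

end
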